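(* Let $P\subseteq\mathbb{R}^2$ be a (non-empty) compact convex set. Then there exists a sequence $(P_m)_{m=1}^\infty$ of vertex generated polytopes in $\mathbb{R}^2$ such that $P_m\to P$ in the Hausdorff metric.
   Context: A polytope is the convex hull of a finite non-empty set of points; $V(P)$ denotes the set of vertices of the polytope $P$; $A+B=\{a+b:a\in A,b\in B\}$ is the Minkowski sum. A polytope $P\subset\mathbb{R}^n$ is called vertex generated if $P+V(P)=2P$. *)

theory Defs
  imports "HOL-Analysis.Analysis"
begin

(* The library predicate polytope also admits the empty set; polytopes here are non-empty,
   so vertex_generated carries non-emptiness explicitly. *)

definition vertices :: "'a::euclidean_space set \<Rightarrow> 'a set" where
  "vertices P = {x. x extreme_point_of P}"

(* The sum of sets is the Minkowski sum of HOL-Library.Set_Algebras; 2P is the dilate. *)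
definition vertex_generated :: "'a::euclidean_space set \<Rightarrow> bool" where
  "vertex_generated P \<longleftrightarrow>
     polytope P \<and> P \<noteq> {} \<and> P + vertices P = (\<lambda>x. 2 *\<^sub>R x) ` P"

(* Only meaningful for non-empty bounded sets: then all suprema below are over
   non-empty sets that are bounded above. *)
definition hausdorff_dist :: "'a::metric_space set \<Rightarrow> 'a set \<Rightarrow> real" where
  "hausdorff_dist A B = max (SUP a\<in>A. infdist a B) (SUP b\<in>B. infdist b A)"

end

theory Submission
  imports Defs
begin

text \<open>
  A polytope \<open>Q\<close> with vertex set \<open>F\<close> is vertex generated iff every \<open>x \<in> Q\<close> has a vertex \<open>v\<close> with
  \<open>2 x - v \<in> Q\<close>. Enclose \<open>P\<close> in a nearby strictly convex body \<open>K\<close>, so that every finite set \<open>F\<close> of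
  boundary points of \<open>K\<close> is the vertex set of its hull. Points \<open>x\<close> deep inside \<open>K\<close> are handled
  by compactness: near \<open>x\<close> finitely many boundary points suffice, because either some boundary point
  \<open>w\<close> has \<open>2 x - w\<close> in the interior of \<open>K\<close>, or \<open>K\<close> contains an inscribed parallelogram centred at
  \<open>x\<close>, and parallelograms are vertex generated. Points near the boundary of the hull are covered as
  soon as the edges are short: if both endpoints of the edge closest to \<open>x\<close> failed, then the chord of
  \<open>Q\<close> parallel to that edge at the reflected height would be shorter than the edge although
  a wide ball lies beyond it, contradicting convexity.
\<close>

section \<open>Planar coordinates and the strictly convex outer body\<close>

lemma orthonormal_frame_2:
  fixes n :: "real ^ 2"
  assumes "norm n = 1"
  obtains u where "norm u = 1" "n \<bullet> u = 0"
    "\<And>v. v = (n \<bullet> v) *\<^sub>R n + (u \<bullet> v) *\<^sub>R u"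
proof
  let ?u = "vector [- (n $ 2), n $ 1] :: real ^ 2"
  have sq: "n $ 1 * n $ 1 + n $ 2 * n $ 2 = 1"
    using assms by (simp add: norm_eq_1 inner_vec_def sum_2)
  show "norm ?u = 1"
    using sq by (simp add: norm_eq_1 inner_vec_def sum_2)
  show "n \<bullet> ?u = 0"
    by (simp add: inner_vec_def sum_2)
  fix v :: "real ^ 2"
  \<comment> \<open>Multiplying each coordinate by \<open>n $ 1 * n $ 1 + n $ 2 * n $ 2 = 1\<close>
    turns the expansion into a polynomial identity.\<close>
  have "v $ 1 = v $ 1 * (n $ 1 * n $ 1 + n $ 2 * n $ 2)" "v $ 2 = v $ 2 * (n $ 1 * n $ 1 + n $ 2 * n $ 2)"
    by (simp_all add: sq)
  then show "v = (n \<bullet> v) *\<^sub>R n + (?u \<bullet> v) *\<^sub>R ?u"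
    by (simp add: vec_eq_iff forall_2 inner_vec_def sum_2 algebra_simps)
qed

lemma infdist_convex_combination:
  fixes S :: "'a::euclidean_space set"
  assumes "closed S" "convex S" "S \<noteq> {}" and t: "0 \<le> t" "t \<le> 1"
  shows "infdist ((1 - t) *\<^sub>R a + t *\<^sub>R b) S \<le> (1 - t) * infdist a S + t * infdist b S"
proof -
  obtain p where p: "p \<in> S" "infdist a S = dist a p"
    using infdist_attains_inf assms by blast
  obtain q where q: "q \<in> S" "infdist b S = dist b q"
    using infdist_attains_inf assms by blast
  have "(1 - t) *\<^sub>R p + t *\<^sub>R q \<in> S"
    using p q t \<open>convex S\<close> by (simp add: convex_alt)
  then have "infdist ((1 - t) *\<^sub>R a + t *\<^sub>R b) S
      \<le> dist ((1 - t) *\<^sub>R a + t *\<^sub>R b) ((1 - t) *\<^sub>R p + t *\<^sub>R q)"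
    by (rule infdist_le)
  also have "\<dots> = norm ((1 - t) *\<^sub>R (a - p) + t *\<^sub>R (b - q))"
    by (simp add: dist_norm algebra_simps)
  also have "\<dots> \<le> (1 - t) * norm (a - p) + t * norm (b - q)"
    using t norm_triangle_ineq[of "(1 - t) *\<^sub>R (a - p)" "t *\<^sub>R (b - q)"] by simp
  finally show ?thesis
    using p q by (simp add: dist_norm)
qed

text \<open>The subtracted term measures how far the squared norm falls below its chord; it is the
  source of all strict convexity below.\<close>

lemma norm_convex_combination_square:
  fixes a b :: "'a::real_inner"
  shows "(norm ((1 - t) *\<^sub>R a + t *\<^sub>R b))\<^sup>2
    = (1 - t) * (norm a)\<^sup>2 + t * (norm b)\<^sup>2 - t * (1 - t) * (norm (a - b))\<^sup>2"
  unfolding power2_norm_eq_inner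
  by (simp add: inner_add_left inner_add_right inner_diff_left inner_diff_right inner_commute[of b a])
     (simp add: algebra_simps)

text \<open>
  \<open>K\<close> is a sublevel set of \<open>infdist x P + c * (norm x)\<^sup>2\<close>, which is strictly convex.
\<close>
lemma strictly_convex_approximation:
  fixes P :: "'a::euclidean_space set"
  assumes "compact P" "convex P" "P \<noteq> {}" "0 < e"
  obtains K where "compact K" "convex K" "P \<subseteq> interior K"
    "\<And>x. x \<in> K \<Longrightarrow> infdist x P \<le> e"
    "\<And>x. x \<in> frontier K \<Longrightarrow> x extreme_point_of K"
proof -
  obtain R where R: "0 < R" "\<And>x. x \<in> P \<Longrightarrow> norm x < R"
    by (metis assms(1) bounded_pos_less compact_imp_bounded)
  \<comment> \<open>With this scale the quadratic term stays below \<open>e\<close> on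
    \<open>P\<close>, which puts \<open>P\<close> in the interior of \<open>K\<close>, and reaches
    \<open>e\<close> at norm \<open>R\<close>, which bounds \<open>K\<close>.\<close>
  define c where "c = e / R\<^sup>2"
  have c: "0 < c" "c * R\<^sup>2 = e"
    using R(1) \<open>0 < e\<close> by (auto simp: c_def)
  define g where "g x = infdist x P + c * (norm x)\<^sup>2" for x
  define K where "K = {x. g x \<le> e}"
  have cont: "continuous_on UNIV g"
    unfolding g_def by (intro continuous_intros)
  have closed: "closed P"
    using assms(1) compact_imp_closed by blast
  have comb: "g ((1 - t) *\<^sub>R a + t *\<^sub>R b) \<le> (1 - t) * g a + t * g b - c * (t * (1 - t) * (norm (a - b))\<^sup>2)"
    if "0 \<le> t" "t \<le> 1" for a b t
    using infdist_convex_combination[OF closed assms(2,3) that, of a b]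
    unfolding g_def norm_convex_combination_square by (simp add: algebra_simps)
  have comb_le: "(1 - t) * g a + t * g b \<le> e" if "0 \<le> t" "t \<le> 1" "a \<in> K" "b \<in> K" for a b t
  proof -
    have "(1 - t) * g a + t * g b \<le> (1 - t) * e + t * e"
      using that by (intro add_mono mult_left_mono) (auto simp: K_def)
    then show ?thesis by (simp add: algebra_simps)
  qed
  have "closed K"
    unfolding K_def using cont by (intro closed_Collect_le) auto
  have "open {x. g x < e}"
    using cont by (intro open_Collect_less) auto
  then have int: "{x. g x < e} \<subseteq> interior K"
    by (intro interior_maximal) (auto simp: K_def)
  have "norm x \<le> R" if "x \<in> K" for x
  proof -
    have "c * (norm x)\<^sup>2 \<le> c * R\<^sup>2"
      using that infdist_nonneg[of x P] unfolding K_def g_def c(2) by simp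
    then have "(norm x)\<^sup>2 \<le> R\<^sup>2"
      using c(1) by (rule mult_left_le_imp_le)
    then show ?thesis
      using R(1) power2_le_imp_le by (meson less_imp_le)
  qed
  then have "bounded K"
    by (auto simp: bounded_iff)
  show thesis
  proof
    show "compact K"
      using \<open>bounded K\<close> \<open>closed K\<close> compact_eq_bounded_closed by blast
    show "convex K"
      unfolding convex_alt
    proof (intro ballI allI impI)
      fix a b t assume h: "a \<in> K" "b \<in> K" "0 \<le> t \<and> (t::real) \<le> 1"
      have "0 \<le> c * (t * (1 - t) * (norm (a - b))\<^sup>2)"
        using h c by (intro mult_nonneg_nonneg) auto
      then show "(1 - t) *\<^sub>R a + t *\<^sub>R b \<in> K"
        using comb[of t a b] comb_le[of t a b] h by (auto simp: K_def)
    qed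
    show "P \<subseteq> interior K"
    proof
      fix x assume "x \<in> P"
      then have "(norm x)\<^sup>2 < R\<^sup>2"
        using R by (intro power_strict_mono) auto
      then have "c * (norm x)\<^sup>2 < e"
        using c by (metis mult_strict_left_mono)
      then show "x \<in> interior K"
        using int \<open>x \<in> P\<close> by (auto simp: g_def)
    qed
    show "infdist x P \<le> e" if "x \<in> K" for x
    proof -
      have "0 \<le> c * (norm x)\<^sup>2"
        using c(1) by simp
      then show ?thesis
        using that by (simp add: K_def g_def)
    qed
    show "x extreme_point_of K" if "x \<in> frontier K" for x
    proof -
      have "x \<in> K"
        using that \<open>closed K\<close> frontier_subset_closed by blast
      \<comment> \<open>A frontier point sits exactly at level \<open>e\<close>, whereas a point
        strictly inside a chord of \<open>K\<close> lies strictly below it.\<close>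
      have "\<not> g x < e"
        using that int by (auto simp: frontier_def)
      have "x \<notin> open_segment a b" if ab: "a \<in> K" "b \<in> K" for a b
      proof
        assume "x \<in> open_segment a b"
        then obtain t where t: "a \<noteq> b" "0 < t" "t < 1" "x = (1 - t) *\<^sub>R a + t *\<^sub>R b"
          by (auto simp: in_segment)
        then have "0 < c * (t * (1 - t) * (norm (a - b))\<^sup>2)"
          using c by (intro mult_pos_pos) auto
        then have "g x < e"
          using comb[of t a b] comb_le[of t a b] ab t by auto
        then show False
          using \<open>\<not> g x < e\<close> by blast
      qed
      then show ?thesis
        using \<open>x \<in> K\<close> by (auto simp: extreme_point_of_def)
    qed
  qed
qed

section \<open>Hulls of finitely many boundary points\<close>

text \<open>The hull of \<open>F\<close> thickened by a ball of radius \<open>d\<close> is convex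
  and contains the frontier, so it contains the hull of the frontier, which is
  \<open>K\<close>.\<close>

lemma infdist_convex_hull_frontier_net:
  fixes K :: "'a::euclidean_space set"
  assumes "compact K" "convex K" "frontier K \<subseteq> (\<Union>v\<in>F. cball v d)" "x \<in> K"
  obtains p where "p \<in> convex hull F" "dist x p \<le> d"
proof -
  let ?S = "\<Union>p\<in>convex hull F. \<Union>h\<in>cball 0 d. {p + h}"
  have "frontier K \<subseteq> ?S"
  proof
    fix y assume "y \<in> frontier K"
    then obtain v where "v \<in> F" "dist v y \<le> d"
      using assms(3) by auto
    then have "v \<in> convex hull F" "y - v \<in> cball 0 d"
      by (auto simp: hull_inc dist_norm norm_minus_commute)
    then show "y \<in> ?S"
      by force
  qed
  moreover have "convex ?S"
    by (intro convex_sums convex_convex_hull convex_cball)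
  ultimately have "convex hull (frontier K) \<subseteq> ?S"
    by (rule hull_minimal)
  then have "x \<in> ?S"
    using assms(4) Krein_Milman_frontier[OF assms(2,1)] by blast
  then obtain p h where "p \<in> convex hull F" "norm h \<le> d" "x = p + h"
    by auto
  then show thesis
    by (intro that[of p]) (auto simp: dist_norm)
qed

text \<open>A fine enough net of the frontier works: if a point with room \<open>2 * d\<close> in
  \<open>K\<close> were separated from the hull, moving \<open>2 * d\<close> away from the hull
  would stay in \<open>K\<close> but end more than \<open>d\<close> away from the hull.\<close>

lemma compact_subset_interior_finite_hull:
  fixes K :: "'a::euclidean_space set"
  assumes "compact K" "convex K" "compact C" "C \<subseteq> interior K"
  obtains F where "finite F" "F \<subseteq> frontier K" "C \<subseteq> interior (convex hull F)"
proof -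
  obtain e where e: "0 < e" "(\<Union>x\<in>C. cball x e) \<subseteq> interior K"
    using compact_subset_open_imp_cball_epsilon_subset[OF assms(3) open_interior assms(4)] by blast
  \<comment> \<open>A point within \<open>d\<close> of \<open>C\<close> keeps a ball of radius
    \<open>2 * d\<close> inside the \<open>e\<close>-ball.\<close>
  define d where "d = e / 3"
  have "compact (frontier K)"
    by (simp add: assms(1) compact_frontier)
  moreover have "0 < d"
    using e(1) by (simp add: d_def)
  ultimately obtain F where F: "finite F" "F \<subseteq> frontier K" "frontier K \<subseteq> (\<Union>v\<in>F. ball v d)"
    using seq_compact_imp_totally_bounded[OF compact_imp_seq_compact] by metis
  then have net: "frontier K \<subseteq> (\<Union>v\<in>F. cball v d)"
    using ball_subset_cball by blast
  have inside: "y \<in> convex hull F" if y: "cball y (2 * d) \<subseteq> K" for y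
  proof (rule ccontr)
    assume "y \<notin> convex hull F"
    moreover have "closed (convex hull F)" 
      using F(1) by (simp add: finite_imp_compact_convex_hull compact_imp_closed)
    ultimately obtain a b where ab: "a \<bullet> y < b" "\<And>p. p \<in> convex hull F \<Longrightarrow> b < a \<bullet> p"
      using separating_hyperplane_closed_point[OF convex_convex_hull, of F y] by blast
    show False
    proof (cases "a = 0")
      \<comment> \<open>A zero normal can separate only from an empty hull, and the net excludes
        that.\<close>
      case True
      have "y \<in> K" using y e(1) by (auto simp: d_def)
      then obtain p where "p \<in> convex hull F"
        using infdist_convex_hull_frontier_net[OF assms(1,2) net] by blast
      with ab True show False by fastforce
    next
      case False
      define n where "n = a /\<^sub>R norm a"
      have n: "norm n = 1" "a \<bullet> n = norm a"
        using False by (simp_all add: n_def power2_norm_eq_inner[symmetric] power2_eq_square)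
      have "y - (2 * d) *\<^sub>R n \<in> K"
        using n(1) e(1) by (intro set_mp[OF y]) (auto simp: dist_norm d_def)
      then obtain p where p: "p \<in> convex hull F" "dist (y - (2 * d) *\<^sub>R n) p \<le> d"
        using infdist_convex_hull_frontier_net[OF assms(1,2) net] by blast
      have "a \<bullet> (p - (y - (2 * d) *\<^sub>R n)) \<le> norm a * d"
        using p(2) by (intro order_trans[OF norm_cauchy_schwarz] mult_left_mono)
          (auto simp: dist_norm norm_minus_commute)
      then have "a \<bullet> p - a \<bullet> y + 2 * d * norm a \<le> norm a * d"
        by (simp add: inner_diff_right n(2))
      moreover have "0 < norm a * d"
        using False e(1) by (simp add: d_def)
      ultimately show False
        using ab(1) ab(2)[OF p(1)] by (simp add: algebra_simps)
    qed
  qed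
  have "C \<subseteq> interior (convex hull F)"
  proof
    fix x assume "x \<in> C"
    have "ball x d \<subseteq> convex hull F"
    proof
      fix y assume "y \<in> ball x d"
      have "cball y (2 * d) \<subseteq> cball x e"
      proof
        fix w assume "w \<in> cball y (2 * d)"
        then show "w \<in> cball x e"
          using \<open>y \<in> ball x d\<close> dist_triangle[of x w y] by (auto simp: d_def)
      qed
      also have "\<dots> \<subseteq> K"
        using e(2) \<open>x \<in> C\<close> interior_subset by blast
      finally show "y \<in> convex hull F"
        by (rule inside)
    qed
    moreover have "x \<in> ball x d"
      using \<open>0 < d\<close> by simp
    ultimately show "x \<in> interior (convex hull F)"
      by (meson interiorI open_ball)
  qed
  then show thesis
    using F that by blast
qed

section \<open>Points near the boundary of the hull\<close>

lemma convex_mem_between_coordinates: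
  fixes P :: "'a::real_inner set"
  assumes "convex P" and frame: "\<And>v. v = (n \<bullet> v) *\<^sub>R n + (u \<bullet> v) *\<^sub>R u"
    and "p \<in> P" "q \<in> P" "n \<bullet> p = n \<bullet> w" "n \<bullet> q = n \<bullet> w" "u \<bullet> p \<le> u \<bullet> w" "u \<bullet> w \<le> u \<bullet> q"
  shows "w \<in> P"
proof -
  have eqI: "a = b" if "n \<bullet> a = n \<bullet> b" "u \<bullet> a = u \<bullet> b" for a b
    using frame[of a] frame[of b] that by simp
  show ?thesis
  proof (cases "u \<bullet> p = u \<bullet> q")
    case True
    then have "w = p"
      using assms by (intro eqI) auto
    then show ?thesis
      using assms by simp
  next
    case False
    define s where "s = (u \<bullet> w - u \<bullet> p) / (u \<bullet> q - u \<bullet> p)"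
    have pos: "u \<bullet> q - u \<bullet> p > 0"
      using False assms by linarith
    then have s: "0 \<le> s" "s \<le> 1" "s * (u \<bullet> q - u \<bullet> p) = u \<bullet> w - u \<bullet> p"
      using assms by (auto simp: s_def)
    have "w = (1 - s) *\<^sub>R p + s *\<^sub>R q"
      using assms s(3) by (intro eqI) (auto simp: inner_add_right algebra_simps)
    then show ?thesis
      using assms s by (simp add: convex_alt)
  qed
qed

text \<open>The face on which \<open>n\<close> is maximal is the hull of a subset of
  \<open>F\<close>; were that subset strictly beyond \<open>y\<close> in direction \<open>u\<close>,
  so would be \<open>y\<close>. Using \<open>u\<close> and \<open>- u\<close> gives points of
  \<open>F\<close> on both sides of \<open>y\<close> on a supporting line.\<close>

lemma exposed_face_point_between:
  fixes F :: "'a::euclidean_space set"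
  assumes "finite F" "y \<in> convex hull F" "\<And>w. w \<in> convex hull F \<Longrightarrow> n \<bullet> w \<le> n \<bullet> y"
  obtains a where "a \<in> F" "n \<bullet> a = n \<bullet> y" "u \<bullet> a \<le> u \<bullet> y"
proof -
  have "(convex hull F \<inter> {w. n \<bullet> w = n \<bullet> y}) face_of (convex hull F)"
    using assms(3) by (intro face_of_Int_supporting_hyperplane_le) auto
  then obtain S where S: "S \<subseteq> F" "convex hull F \<inter> {w. n \<bullet> w = n \<bullet> y} = convex hull S"
    using face_of_convex_hull_subset[OF finite_imp_compact[OF assms(1)]] by metis
  have "\<exists>a\<in>S. u \<bullet> a \<le> u \<bullet> y"
  proof (rule ccontr)
    assume "\<not> (\<exists>a\<in>S. u \<bullet> a \<le> u \<bullet> y)"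
    then have "S \<subseteq> {w. u \<bullet> w > u \<bullet> y}"
      by auto
    then have "convex hull S \<subseteq> {w. u \<bullet> w > u \<bullet> y}"
      by (intro hull_minimal convex_halfspace_gt)
    moreover have "y \<in> convex hull S"
      using S(2) assms(2) by blast
    ultimately show False by auto
  qed
  then obtain a where "a \<in> S" "u \<bullet> a \<le> u \<bullet> y" by blast
  moreover have "a \<in> convex hull F \<inter> {w. n \<bullet> w = n \<bullet> y}"
    unfolding S(2) using \<open>a \<in> S\<close> by (rule hull_inc)
  ultimately show thesis
    using that S(1) by blast
qed

text \<open>The assumption \<open>short\<close> bounds edge lengths without mentioning edges: the
  midpoint of an edge is not interior, so no edge has length \<open>2 * r\<close> or more. It also
  survives any enlargement of the hull.\<close>

lemma covered_near_boundary:
  fixes F :: "(real ^ 2) set"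
  assumes "finite F" "0 < r" "cball z r \<subseteq> convex hull F"
    and short: "\<And>a b. a \<in> F \<Longrightarrow> b \<in> F \<Longrightarrow> 2 * r \<le> dist a b \<Longrightarrow> midpoint a b \<in> interior (convex hull F)"
    and x: "x \<in> convex hull F" "\<not> cball x (r / 2) \<subseteq> convex hull F"
  shows "\<exists>v\<in>F. 2 *\<^sub>R x - v \<in> convex hull F"
proof (rule ccontr)
  assume "\<not> ?thesis"
  then have out: "2 *\<^sub>R x - v \<notin> convex hull F" if "v \<in> F" for v
    using that by blast
  define P where "P = convex hull F"
  have P: "compact P" "closed P" "convex P"
    using assms(1) by (auto simp: P_def finite_imp_compact_convex_hull compact_imp_closed)
  obtain w where w: "dist x w \<le> r / 2" "w \<notin> P"
    using x(2) by (auto simp only: P_def subset_iff mem_cball)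
  then have "closed_segment x w \<inter> frontier P \<noteq> {}"
    using x(1) by (intro connected_Int_frontier) (auto simp: P_def)
  then obtain y0 where y0: "y0 \<in> closed_segment x w" "y0 \<in> frontier P"
    by blast
  then have "dist x y0 \<le> r / 2"
    using w(1) dist_in_closed_segment[OF y0(1)] by (simp add: dist_commute)
  moreover obtain y where y: "y \<in> frontier P" "\<And>z. z \<in> frontier P \<Longrightarrow> dist x y \<le> dist x z"
    using distance_attains_inf[OF frontier_closed, of P x] y0(2) by blast
  moreover define d where "d = dist x y"
  ultimately have d: "0 \<le> d" "d \<le> r / 2"
    using y0(2) order_trans[of "dist x y" "dist x y0" "r / 2"] by (auto simp only: zero_le_dist)
  have ball: "cball x d \<subseteq> P"
  proof (cases "d = 0")
    case True
    then show ?thesis using x by (auto simp: P_def)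
  next
    case False
    have "ball x d \<subseteq> P"
    proof (rule ccontr)
      assume "\<not> ball x d \<subseteq> P"
      moreover have "x \<in> ball x d \<inter> P"
        using x False d by (auto simp: P_def)
      ultimately have "ball x d \<inter> frontier P \<noteq> {}"
        by (intro connected_Int_frontier connected_ball) blast+
      then show False
        using y(2) by (fastforce simp: d_def)
    qed
    then have "closure (ball x d) \<subseteq> P"
      using P(2) by (rule closure_minimal)
    then show ?thesis
      using False d by simp
  qed
  have "y \<in> P"
    using y(1) P(2) frontier_subset_closed by blast
  have "ball z r \<subseteq> P"
    using assms(3) ball_subset_cball unfolding P_def by blast
  then have "z \<in> interior P"
    using assms(2) by (intro interiorI[OF open_ball]) auto
  then have relint: "rel_interior P = interior P"
    using rel_interior_nonempty_interior by blast
  obtain a0 where a0: "a0 \<noteq> 0" "\<And>w. w \<in> P \<Longrightarrow> a0 \<bullet> y \<le> a0 \<bullet> w"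
    using supporting_hyperplane_relative_frontier[OF P(3), of y] relint y(1) closure_closed[OF P(2)]
    unfolding frontier_def by (metis DiffD1 DiffD2)
  \<comment> \<open>The supporting functional is minimal at \<open>y\<close>; the sign flip makes
    \<open>n\<close> an outward unit normal.\<close>
  define n where "n = - a0 /\<^sub>R norm a0"
  have n: "norm n = 1"
    using a0(1) by (simp add: n_def)
  have sup: "n \<bullet> w \<le> n \<bullet> y" if "w \<in> P" for w
    using a0(2)[OF that] a0(1) by (simp add: n_def divide_right_mono)
  obtain u where u: "norm u = 1" "n \<bullet> u = 0"
    and frame: "\<And>v. v = (n \<bullet> v) *\<^sub>R n + (u \<bullet> v) *\<^sub>R u"
    using orthonormal_frame_2[OF n] by blast
  have nn: "n \<bullet> n = 1" "u \<bullet> u = 1" "u \<bullet> n = 0"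
    using n u by (auto simp: norm_eq_1 inner_commute)
  have pyth: "(norm v)\<^sup>2 = (n \<bullet> v)\<^sup>2 + (u \<bullet> v)\<^sup>2" for v
  proof -
    have "v \<bullet> v = ((n \<bullet> v) *\<^sub>R n + (u \<bullet> v) *\<^sub>R u) \<bullet> v"
      by (rule arg_cong[where f = "\<lambda>w. w \<bullet> v"]) (rule frame)
    also have "\<dots> = (n \<bullet> v)\<^sup>2 + (u \<bullet> v)\<^sup>2"
      by (simp only: inner_add_left inner_scaleR_left power2_eq_square)
    finally show ?thesis
      by (simp only: power2_norm_eq_inner)
  qed
  \<comment> \<open>The ball of radius \<open>d\<close> around \<open>x\<close> lies in
    \<open>P\<close> and touches the supporting line at \<open>y\<close>, so \<open>y\<close> is
    straight above \<open>x\<close> at height \<open>d\<close>.\<close>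
  have "x + d *\<^sub>R n \<in> P"
    using ball d n by (auto simp: dist_norm subset_iff)
  from sup[OF this] have "n \<bullet> x + d \<le> n \<bullet> y"
    by (simp add: inner_add_right nn)
  moreover have "n \<bullet> (y - x) \<le> d"
    using norm_cauchy_schwarz[of n "y - x"] n by (simp add: d_def dist_norm norm_minus_commute)
  ultimately have ny: "n \<bullet> y = n \<bullet> x + d"
    by (simp add: inner_diff_right)
  have "(norm (y - x))\<^sup>2 = d\<^sup>2"
    by (simp add: d_def dist_norm norm_minus_commute)
  then have uy: "u \<bullet> y = u \<bullet> x"
    using pyth[of "y - x"] ny by (simp add: inner_diff_right)
  have refl: "2 *\<^sub>R x - y \<in> P"
    by (intro set_mp[OF ball]) (simp add: d_def dist_norm scaleR_2 norm_minus_commute)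
  obtain b where b: "b \<in> F" "n \<bullet> b = n \<bullet> y" "u \<bullet> b \<le> u \<bullet> y"
    using exposed_face_point_between[OF assms(1), of y n u] \<open>y \<in> P\<close> sup P_def by blast
  obtain a where a: "a \<in> F" "n \<bullet> a = n \<bullet> y" "- u \<bullet> a \<le> - u \<bullet> y"
    using exposed_face_point_between[OF assms(1), of y n "- u"] \<open>y \<in> P\<close> sup P_def by blast
  have inP: "a \<in> P" "b \<in> P"
    using a b by (auto simp: P_def hull_inc)
  have small: "u \<bullet> a - u \<bullet> b < 2 * r"
  proof (rule ccontr)
    assume "\<not> ?thesis"
    moreover have "u \<bullet> (a - b) \<le> dist a b"
      using norm_cauchy_schwarz[of u "a - b"] u by (simp add: dist_norm)
    ultimately have "midpoint a b \<in> interior P"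
      using short[OF a(1) b(1)] by (simp add: P_def inner_diff_right)
    then obtain e where e: "0 < e" "cball (midpoint a b) e \<subseteq> P"
      by (meson mem_interior_cball)
    have "midpoint a b + e *\<^sub>R n \<in> P"
      using e n by (intro set_mp[OF e(2)]) (simp add: dist_norm)
    from sup[OF this] show False
      using a b e(1) by (simp add: midpoint_def inner_add_right nn)
  qed
  \<comment> \<open>\<open>g1\<close> and \<open>g2\<close> lie at the height of \<open>2 x - y\<close>, on the segments from \<open>a\<close>, \<open>b\<close> to the ends of the
    diameter along \<open>u\<close> of the ball around \<open>z\<close>; the points \<open>2 x - a\<close>, \<open>2 x - b\<close> outside \<open>P\<close> must enclose them.\<close>
  define t where "t = n \<bullet> z - n \<bullet> x"
  have zn: "z + r *\<^sub>R n \<in> P" "z + r *\<^sub>R u \<in> P" "z - r *\<^sub>R u \<in> P"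
    using assms(2,3) n u by (auto simp: P_def dist_norm subset_iff)
  have t: "t + r \<le> d"
    using sup[OF zn(1)] ny by (simp add: t_def inner_add_right nn)
  \<comment> \<open>Here \<open>d \<le> r / 2\<close> enters: the centre \<open>z\<close> lies at or
    below the reflected level.\<close>
  then have "t \<le> - d"
    using d by linarith
  \<comment> \<open>Relative to \<open>x\<close>, going from height \<open>d\<close> to height
    \<open>t\<close> passes height \<open>- d\<close> at this weight.\<close>
  define l where "l = 2 * d / (d - t)"
  have dt: "0 < d - t"
    using t assms(2) by linarith
  then have l: "0 \<le> l" "l \<le> 1" "l * (d - t) = 2 * d"
    using d \<open>t \<le> - d\<close> by (auto simp: l_def)
  define g1 where "g1 = (1 - l) *\<^sub>R a + l *\<^sub>R (z + r *\<^sub>R u)"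
  define g2 where "g2 = (1 - l) *\<^sub>R b + l *\<^sub>R (z - r *\<^sub>R u)"
  have g: "g1 \<in> P" "g2 \<in> P"
    unfolding g1_def g2_def using zn inP l P(3) by (auto simp: convex_alt)
  have level: "n \<bullet> x + ((1 - l) * d + l * t) = n \<bullet> x - d"
    using l(3) by (simp add: algebra_simps)
  have nz: "n \<bullet> z = n \<bullet> x + t"
    by (simp add: t_def)
  have ng: "n \<bullet> g1 = n \<bullet> x - d" "n \<bullet> g2 = n \<bullet> x - d"
    using level unfolding g1_def g2_def
    by (simp_all add: inner_add_right inner_diff_right u a b ny nz algebra_simps)
  have "u \<bullet> g1 - u \<bullet> g2 = (1 - l) * (u \<bullet> a - u \<bullet> b) + l * (2 * r)"
    unfolding g1_def g2_def by (simp add: inner_add_right inner_diff_right nn algebra_simps)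
  moreover have "l * (u \<bullet> a - u \<bullet> b) \<le> l * (2 * r)"
    using small l by (intro mult_left_mono) auto
  ultimately have wide: "u \<bullet> a - u \<bullet> b \<le> u \<bullet> g1 - u \<bullet> g2"
    by (simp add: algebra_simps)
  \<comment> \<open>The reflections of \<open>a\<close> and \<open>b\<close> share the level of
    \<open>2 *\<^sub>R x - y\<close> and lie on either side of it. Being outside \<open>P\<close>,
    they lie beyond \<open>g2\<close> and \<open>g1\<close>, so the chord from \<open>g2\<close> to
    \<open>g1\<close> is shorter than the edge.\<close>
  have "u \<bullet> g1 < u \<bullet> (2 *\<^sub>R x - b)"
  proof (rule ccontr)
    assume "\<not> ?thesis"
    then have "2 *\<^sub>R x - b \<in> P"
      using b ng ny uy
      by (intro convex_mem_between_coordinates[OF P(3) frame refl g(1)])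
        (auto simp: inner_diff_right)
    then show False
      using out[OF b(1)] by (simp add: P_def)
  qed
  moreover have "u \<bullet> (2 *\<^sub>R x - a) < u \<bullet> g2"
  proof (rule ccontr)
    assume "\<not> ?thesis"
    then have "2 *\<^sub>R x - a \<in> P"
      using a ng ny uy
      by (intro convex_mem_between_coordinates[OF P(3) frame g(2) refl])
        (auto simp: inner_diff_right)
    then show False
      using out[OF a(1)] by (simp add: P_def)
  qed
  ultimately show False
    using wide by (simp add: inner_diff_right)
qed

section \<open>Points deep inside the body\<close>

text \<open>In the coordinates \<open>a\<close>, \<open>b\<close> the hull is the unit ball of the
  sum norm. Subtracting from the doubled point the vertex along the coordinate of larger absolute
  value, with its sign, leads back into that ball.\<close>

lemma parallelogram_covered:
  fixes p q :: "'a::real_vector"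
  defines "V \<equiv> {p, - p, q, - q}"
  assumes ab: "\<bar>a\<bar> + \<bar>b\<bar> \<le> 1"
  shows "\<exists>v\<in>V. 2 *\<^sub>R (a *\<^sub>R p + b *\<^sub>R q) - v \<in> convex hull V"
proof -
  have zero: "0 \<in> convex hull V"
  proof -
    have "(1 - 1 / 2) *\<^sub>R p + (1 / 2 :: real) *\<^sub>R (- p) \<in> convex hull V"
      by (rule convexD_alt[OF convex_convex_hull]) (auto simp: V_def hull_inc)
    then show ?thesis by simp
  qed
  have comb: "s *\<^sub>R p + t *\<^sub>R q \<in> convex hull V" if st: "\<bar>s\<bar> + \<bar>t\<bar> \<le> 1" for s t
  proof -
    \<comment> \<open>Choosing signs makes the weights nonnegative; the remaining weight goes to
      \<open>0\<close>.\<close>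
    define p' where "p' = (if 0 \<le> s then p else - p)"
    define q' where "q' = (if 0 \<le> t then q else - q)"
    have "\<bar>s\<bar> *\<^sub>R p' + \<bar>t\<bar> *\<^sub>R q' + (1 - \<bar>s\<bar> - \<bar>t\<bar>) *\<^sub>R 0 \<in> convex hull {p', q', 0}"
      unfolding convex_hull_3 using st by fastforce
    also have "convex hull {p', q', 0} \<subseteq> convex hull V"
      using zero by (intro hull_minimal convex_convex_hull)
        (auto simp: p'_def q'_def V_def hull_inc)
    finally show ?thesis
      by (simp add: p'_def q'_def abs_if split: if_splits)
  qed
  have v: "2 *\<^sub>R (a *\<^sub>R p + b *\<^sub>R q) - p = (2 * a - 1) *\<^sub>R p + (2 * b) *\<^sub>R q"
    "2 *\<^sub>R (a *\<^sub>R p + b *\<^sub>R q) - (- p) = (2 * a + 1) *\<^sub>R p + (2 * b) *\<^sub>R q"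
    "2 *\<^sub>R (a *\<^sub>R p + b *\<^sub>R q) - q = (2 * a) *\<^sub>R p + (2 * b - 1) *\<^sub>R q"
    "2 *\<^sub>R (a *\<^sub>R p + b *\<^sub>R q) - (- q) = (2 * a) *\<^sub>R p + (2 * b + 1) *\<^sub>R q"
    by (simp_all add: algebra_simps)
  consider "\<bar>2 * a - 1\<bar> + \<bar>2 * b\<bar> \<le> 1" | "\<bar>2 * a + 1\<bar> + \<bar>2 * b\<bar> \<le> 1"
    | "\<bar>2 * a\<bar> + \<bar>2 * b - 1\<bar> \<le> 1" | "\<bar>2 * a\<bar> + \<bar>2 * b + 1\<bar> \<le> 1"
    using ab by linarith
  then show ?thesis
  proof cases
    case 1
    then show ?thesis using comb v(1) by (intro bexI[of _ p]) (auto simp: V_def)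
  next
    case 2
    then show ?thesis using comb v(2) by (intro bexI[of _ "- p"]) (auto simp: V_def)
  next
    case 3
    then show ?thesis using comb v(3) by (intro bexI[of _ q]) (auto simp: V_def)
  next
    case 4
    then show ?thesis using comb v(4) by (intro bexI[of _ "- q"]) (auto simp: V_def)
  qed
qed

text \<open>Compare the exit distances along \<open>l\<close> and \<open>- l\<close>: the nearer
  exit point reflects to an interior point, and equal distances make \<open>x\<close> the midpoint
  of its chord.\<close>

lemma reflected_frontier_point_cases:
  fixes K :: "'a::euclidean_space set"
  assumes "bounded K" "x \<in> interior K" "l \<noteq> 0"
  obtains w where "w \<in> frontier K" "2 *\<^sub>R x - w \<in> interior K"
  | d where "0 < d" "x + d *\<^sub>R l \<in> frontier K" "x - d *\<^sub>R l \<in> frontier K"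
proof -
  obtain d1 where d1: "0 < d1" "x + d1 *\<^sub>R l \<in> frontier K"
    "\<And>e. 0 \<le> e \<Longrightarrow> e < d1 \<Longrightarrow> x + e *\<^sub>R l \<in> interior K"
    using ray_to_frontier[OF assms] by blast
  obtain d2 where d2: "0 < d2" "x + d2 *\<^sub>R (- l) \<in> frontier K"
    "\<And>e. 0 \<le> e \<Longrightarrow> e < d2 \<Longrightarrow> x + e *\<^sub>R (- l) \<in> interior K"
    using ray_to_frontier[OF assms(1,2), of "- l"] assms(3) by auto
  consider "d1 < d2" | "d1 = d2" | "d2 < d1" by linarith
  then show thesis
  proof cases
    case 1
    then show thesis
      using that(1)[of "x + d1 *\<^sub>R l"] d1 d2(3)[of d1] by (simp add: scaleR_2)
  next
    case 2
    then show thesis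
      using that(2)[of d1] d1 d2 by simp
  next
    case 3
    then show thesis
      using that(1)[of "x - d2 *\<^sub>R l"] d2 d1(3)[of d2] by (simp add: scaleR_2)
  qed
qed

text \<open>Coverage is claimed on a neighbourhood of \<open>x\<close>, so that finitely many such
  sets \<open>F\<close> suffice on a compact set.\<close>

lemma covered_near_interior_point:
  fixes K :: "(real ^ 2) set"
  assumes K: "compact K" "convex K" and x: "x \<in> interior K"
  shows "\<exists>F. finite F \<and> F \<subseteq> frontier K \<and>
    x \<in> interior {y. \<exists>v\<in>F. 2 *\<^sub>R y - v \<in> convex hull F}"
proof (cases "\<exists>w\<in>frontier K. 2 *\<^sub>R x - w \<in> interior K")
  case True
  then obtain w where w: "w \<in> frontier K" "2 *\<^sub>R x - w \<in> interior K"
    by blast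
  obtain F where F: "finite F" "F \<subseteq> frontier K" "{2 *\<^sub>R x - w} \<subseteq> interior (convex hull F)"
    using compact_subset_interior_finite_hull[OF K, of "{2 *\<^sub>R x - w}"] w(2) by auto
  define U where "U = (\<lambda>y. 2 *\<^sub>R y - w) -` interior (convex hull F)"
  have "open U"
    unfolding U_def by (intro open_vimage open_interior continuous_intros)
  moreover have "U \<subseteq> {y. \<exists>v\<in>insert w F. 2 *\<^sub>R y - v \<in> convex hull (insert w F)}"
    using interior_subset hull_mono[of F "insert w F" convex] unfolding U_def by blast
  moreover have "x \<in> U"
    using F(3) by (simp add: U_def)
  ultimately show ?thesis
    using F(1,2) w(1) by (intro exI[of _ "insert w F"]) (auto intro: interiorI)
next
  case False
  have bdd: "bounded K"
    using K(1) by (rule compact_imp_bounded)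
  \<comment> \<open>Only the symmetric case is left, so the chords along both axes are bisected by
    \<open>x\<close> and are the diagonals of a parallelogram.\<close>
  obtain s where s: "0 < s" "x + s *\<^sub>R axis 1 1 \<in> frontier K" "x - s *\<^sub>R axis 1 1 \<in> frontier K"
    by (rule reflected_frontier_point_cases[OF bdd x, of "axis 1 1"]) (use False in auto)
  obtain t where t: "0 < t" "x + t *\<^sub>R axis 2 1 \<in> frontier K" "x - t *\<^sub>R axis 2 1 \<in> frontier K"
    by (rule reflected_frontier_point_cases[OF bdd x, of "axis 2 1"]) (use False in auto)
  define p q where "p = s *\<^sub>R (axis 1 1 :: real ^ 2)" and "q = t *\<^sub>R (axis 2 1 :: real ^ 2)"
  define V where "V = {p, - p, q, - q}"
  define F where "F = (\<lambda>v. x + v) ` V"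
  define U where "U = {y. \<bar>(y - x) $ 1 / s\<bar> + \<bar>(y - x) $ 2 / t\<bar> < 1}"
  have "\<exists>v\<in>F. 2 *\<^sub>R y - v \<in> convex hull F" if "y \<in> U" for y
  proof -
    have y: "((y - x) $ 1 / s) *\<^sub>R p + ((y - x) $ 2 / t) *\<^sub>R q = y - x"
      using s(1) t(1) by (simp add: p_def q_def vec_eq_iff forall_2 axis_def)
    have "\<bar>(y - x) $ 1 / s\<bar> + \<bar>(y - x) $ 2 / t\<bar> \<le> 1"
      using that by (simp add: U_def)
    from parallelogram_covered[OF this, of p q]
    obtain v where v: "v \<in> V" "2 *\<^sub>R (y - x) - v \<in> convex hull V"
      unfolding y V_def[symmetric] by blast
    have "2 *\<^sub>R y - (x + v) = x + (2 *\<^sub>R (y - x) - v)"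
      by (simp add: scaleR_2)
    then have "2 *\<^sub>R y - (x + v) \<in> convex hull F"
      unfolding F_def convex_hull_translation using v(2) by auto
    then show ?thesis
      using v(1) unfolding F_def by blast
  qed
  then have "U \<subseteq> {y. \<exists>v\<in>F. 2 *\<^sub>R y - v \<in> convex hull F}"
    by blast
  moreover have "open U"
    unfolding U_def by (intro open_Collect_less continuous_intros) (use s t in auto)
  moreover have "x \<in> U" "finite F" "F \<subseteq> frontier K"
    using s t by (auto simp: U_def F_def V_def p_def q_def)
  ultimately show ?thesis
    by (meson interiorI)
qed

section \<open>Assembling the inscribed polytope\<close>

text \<open>One inclusion is convexity applied to midpoints; the other is exactly
  \<open>cov\<close>.\<close>

lemma vertex_generated_convex_hull:
  assumes "finite F" "F \<noteq> {}" and ext: "\<And>v. v \<in> F \<Longrightarrow> v extreme_point_of (convex hull F)"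
    and cov: "\<And>x. x \<in> convex hull F \<Longrightarrow> \<exists>v\<in>F. 2 *\<^sub>R x - v \<in> convex hull F"
  shows "vertex_generated (convex hull F)"
  unfolding vertex_generated_def
proof (intro conjI)
  show "polytope (convex hull F)"
    using assms(1) by (rule polytope_convex_hull)
  show "convex hull F \<noteq> {}"
    using assms(2) by simp
  have V: "vertices (convex hull F) = F"
    using ext extreme_point_of_convex_hull unfolding vertices_def by blast
  show "convex hull F + vertices (convex hull F) = (*\<^sub>R) 2 ` (convex hull F)"
    unfolding V
  proof (intro set_eqI iffI)
    fix y assume "y \<in> convex hull F + F"
    then obtain p v where y: "p \<in> convex hull F" "v \<in> F" "y = p + v"
      by (auto simp: set_plus_def)
    then have "(1 - 1 / 2) *\<^sub>R p + (1 / 2) *\<^sub>R v \<in> convex hull F"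
      by (intro convexD_alt[OF convex_convex_hull]) (auto simp: hull_inc)
    moreover have "y = 2 *\<^sub>R ((1 - 1 / 2) *\<^sub>R p + (1 / 2) *\<^sub>R v)"
      by (simp add: y algebra_simps)
    ultimately show "y \<in> (*\<^sub>R) 2 ` (convex hull F)"
      by blast
  next
    fix y assume "y \<in> (*\<^sub>R) 2 ` (convex hull F)"
    then obtain x where x: "x \<in> convex hull F" "y = 2 *\<^sub>R x"
      by blast
    then obtain v where v: "v \<in> F" "2 *\<^sub>R x - v \<in> convex hull F"
      using cov by blast
    have "y = (2 *\<^sub>R x - v) + v"
      by (simp add: x)
    then show "y \<in> convex hull F + F"
      using v set_plus_intro by metis
  qed
qed

lemma vertex_generated_inscribed_approximation:
  fixes K :: "(real ^ 2) set"
  assumes K: "compact K" "convex K" "interior K \<noteq> {}"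
    and ext: "\<And>x. x \<in> frontier K \<Longrightarrow> x extreme_point_of K" and "0 < e"
  obtains Q where "vertex_generated Q" "Q \<subseteq> K" "\<And>x. x \<in> K \<Longrightarrow> infdist x Q \<le> e"
proof -
  obtain z r where r: "0 < r" "cball z r \<subseteq> interior K"
    using K(3) open_contains_cball_eq[OF open_interior[of K]] by blast
  have frK: "frontier K \<subseteq> K"
    using K(1) by (simp add: compact_imp_closed frontier_subset_closed)
  have cfr: "compact (frontier K)"
    using K(1) by (rule compact_frontier)
  \<comment> \<open>The midpoints of long chords form a compact set, interior to \<open>K\<close> by
    strict convexity. Enclosing \<open>M\<close> in the hull of \<open>F1\<close> secures the
    assumption \<open>short\<close> of \<open>covered_near_boundary\<close>.\<close>
  define M where "M = (\<lambda>(a, b). midpoint a b) ` ({(a, b). 2 * r \<le> dist a b} \<inter> frontier K \<times> frontier K)"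
  have "closed {(a :: real ^ 2, b). 2 * r \<le> dist a b}"
    unfolding case_prod_beta by (intro closed_Collect_le continuous_intros)
  then have "compact M"
    unfolding M_def case_prod_beta midpoint_def
    by (intro compact_continuous_image continuous_intros closed_Int_compact compact_Times cfr)
  have "M \<subseteq> interior K"
  proof
    fix m assume "m \<in> M"
    then obtain a b where ab: "a \<in> K" "b \<in> K" "2 * r \<le> dist a b" "m = midpoint a b"
      using frK unfolding M_def by auto
    then have "m \<in> open_segment a b"
      using r(1) by auto
    then have "m \<notin> frontier K"
      using ext ab(1,2) unfolding extreme_point_of_def by blast
    moreover have "m \<in> K"
      using \<open>m \<in> open_segment a b\<close> ab K(2) by (meson convex_contains_open_segment subsetD)
    ultimately show "m \<in> interior K"
      using closure_subset by (auto simp: frontier_def)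
  qed
  then obtain F1 where F1: "finite F1" "F1 \<subseteq> frontier K" "cball z r \<union> M \<subseteq> interior (convex hull F1)"
    using compact_subset_interior_finite_hull[OF K(1,2), of "cball z r \<union> M"] r(2) \<open>compact M\<close>
    by (metis Un_least compact_Un compact_cball)
  \<comment> \<open>Depth is measured in \<open>K\<close>, so \<open>D\<close> is fixed before
    \<open>F\<close> is chosen and still contains every point that is deep in a hull inside
    \<open>K\<close>.\<close>
  define D where "D = {x. cball x (r / 2) \<subseteq> K}"
  have D: "D \<subseteq> interior K"
  proof
    fix x assume "x \<in> D"
    then show "x \<in> interior K"
      using r(1) unfolding D_def mem_interior_cball by (intro exI[of _ "r / 2"]) auto
  qed
  \<comment> \<open>As an intersection of translates of \<open>K\<close>, the set \<open>D\<close>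
    is closed.\<close>
  have "D = (\<Inter>h\<in>cball 0 (r / 2). (\<lambda>x. x + h) -` K)"
  proof (intro set_eqI iffI)
    fix x assume "x \<in> D"
    then show "x \<in> (\<Inter>h\<in>cball 0 (r / 2). (\<lambda>x. x + h) -` K)"
      by (auto simp: D_def dist_norm subset_iff)
  next
    fix x assume x: "x \<in> (\<Inter>h\<in>cball 0 (r / 2). (\<lambda>x. x + h) -` K)"
    have "y \<in> K" if "y \<in> cball x (r / 2)" for y
    proof -
      have "y - x \<in> cball 0 (r / 2)"
        using that by (simp add: dist_norm norm_minus_commute)
      then have "x + (y - x) \<in> K"
        using x by blast
      then show ?thesis by simp
    qed
    then show "x \<in> D"
      by (auto simp: D_def)
  qed
  moreover have "closed ((\<lambda>x. x + h) -` K)" for h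
    using K(1) by (intro closed_vimage continuous_intros) (simp add: compact_imp_closed)
  ultimately have "closed D"
    by auto
  moreover have "bounded D"
    using D K(1) by (meson bounded_subset compact_imp_bounded interior_subset)
  ultimately have "compact D"
    by (simp add: compact_eq_bounded_closed)
  define U where "U F = interior {y. \<exists>v\<in>F. 2 *\<^sub>R y - v \<in> convex hull F}" for F :: "(real ^ 2) set"
  have "\<forall>x\<in>D. \<exists>F. finite F \<and> F \<subseteq> frontier K \<and> x \<in> U F"
    using covered_near_interior_point[OF K(1,2)] D unfolding U_def by blast
  from bchoice[OF this] obtain G
    where G: "\<And>x. x \<in> D \<Longrightarrow> finite (G x) \<and> G x \<subseteq> frontier K \<and> x \<in> U (G x)"
    by blast
  have "\<And>x. x \<in> D \<Longrightarrow> open (U (G x))" "D \<subseteq> (\<Union>x\<in>D. U (G x))"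
    using G by (auto simp: U_def)
  from compactE_image[OF \<open>compact D\<close> this]
  obtain C where C: "C \<subseteq> D" "finite C" "D \<subseteq> (\<Union>c\<in>C. U (G c))"
    by metis
  obtain F2 where F2: "finite F2" "F2 \<subseteq> frontier K" "frontier K \<subseteq> (\<Union>v\<in>F2. ball v e)"
    using seq_compact_imp_totally_bounded[OF compact_imp_seq_compact[OF cfr]] \<open>0 < e\<close> by metis
  \<comment> \<open>\<open>F1\<close> handles the points near the boundary, \<open>F2\<close> the
    distance to \<open>K\<close>, and the sets \<open>G c\<close> the points of \<open>D\<close>.
    Each property persists when further frontier points are added.\<close>
  define F where "F = F1 \<union> F2 \<union> (\<Union>c\<in>C. G c)"
  have sub: "convex hull (G c) \<subseteq> convex hull F" if "c \<in> C" for c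
    using that by (auto simp: F_def intro!: hull_mono)
  have FK: "finite F" "F \<subseteq> frontier K"
    using F1 F2 C(1,2) G unfolding F_def by (blast intro: finite_UN_I)+
  then have hullK: "convex hull F \<subseteq> K"
    using frK K(2) by (intro hull_minimal) auto
  have sub1: "interior (convex hull F1) \<subseteq> interior (convex hull F)"
    by (intro interior_mono hull_mono) (auto simp: F_def)
  have zr: "cball z r \<subseteq> convex hull F"
    using F1(3) sub1 interior_subset by blast
  have cover: "\<exists>v\<in>F. 2 *\<^sub>R x - v \<in> convex hull F" if x: "x \<in> convex hull F" for x
  proof (cases "cball x (r / 2) \<subseteq> convex hull F")
    case True
    then have "x \<in> D"
      using hullK by (auto simp: D_def)
    then obtain c where c: "c \<in> C" "x \<in> U (G c)"
      using C(3) by blast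
    then obtain v where "v \<in> G c" "2 *\<^sub>R x - v \<in> convex hull (G c)"
      using interior_subset unfolding U_def by blast
    then show ?thesis
      using sub[OF c(1)] c(1) unfolding F_def by blast
  next
    case False
    show ?thesis
    proof (rule covered_near_boundary[OF FK(1) r(1) zr _ x False])
      fix a b assume "a \<in> F" "b \<in> F" "2 * r \<le> dist a b"
      then have "midpoint a b \<in> M"
        using FK(2) by (auto simp: M_def)
      then show "midpoint a b \<in> interior (convex hull F)"
        using F1(3) sub1 by blast
    qed
  qed
  show thesis
  proof (rule that[OF vertex_generated_convex_hull[OF FK(1) _ _ cover] hullK])
    show "F \<noteq> {}"
      using zr r(1) by auto
    \<comment> \<open>An extreme point of \<open>K\<close> remains extreme in any subset that
      contains it.\<close>
    show "v extreme_point_of (convex hull F)" if "v \<in> F" for v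
      using that ext[of v] FK(2) hullK by (auto simp: extreme_point_of_def hull_inc)
    show "infdist x (convex hull F) \<le> e" if xK: "x \<in> K" for x
    proof -
      have "frontier K \<subseteq> (\<Union>v\<in>F. cball v e)"
        using F2(3) ball_subset_cball unfolding F_def by blast
      then obtain p where "p \<in> convex hull F" "dist x p \<le> e"
        using infdist_convex_hull_frontier_net[OF K(1,2) _ xK] by blast
      then show ?thesis
        by (meson infdist_le order_trans)
    qed
  qed
qed

section \<open>Hausdorff distance and conclusion\<close>

lemma hausdorff_dist_le:
  assumes "A \<noteq> {}" "B \<noteq> {}"
    and "\<And>x. x \<in> A \<Longrightarrow> infdist x B \<le> e" "\<And>x. x \<in> B \<Longrightarrow> infdist x A \<le> e"
  shows "\<bar>hausdorff_dist A B\<bar> \<le> e"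
proof -
  obtain a where a: "a \<in> A" using assms(1) by blast
  have "0 \<le> infdist a B"
    by (rule infdist_nonneg)
  also have "\<dots> \<le> (SUP a\<in>A. infdist a B)"
    \<comment> \<open>The bound \<open>e\<close> makes the supremum genuine, so that it dominates a
      nonnegative member.\<close>
    using a assms(3) by (intro cSUP_upper bdd_aboveI2[of _ _ e])
  finally have "0 \<le> hausdorff_dist A B"
    by (simp add: hausdorff_dist_def)
  moreover have "hausdorff_dist A B \<le> e"
    unfolding hausdorff_dist_def using assms by (intro max.boundedI cSUP_least)
  ultimately show ?thesis by simp
qed

theorem theorem1p5:
  fixes P :: "(real ^ 2) set"
  assumes "compact P" and "convex P" and "P \<noteq> {}"
  shows "\<exists>Q :: nat \<Rightarrow> (real ^ 2) set.
           (\<forall>m. vertex_generated (Q m)) \<and>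
           (\<lambda>m. hausdorff_dist (Q m) P) \<longlonglongrightarrow> 0"
proof -
  have "\<exists>Q. vertex_generated Q \<and> \<bar>hausdorff_dist Q P\<bar> \<le> e" if "0 < e" for e
  proof -
    obtain K where K: "compact K" "convex K" "P \<subseteq> interior K"
        "\<And>x. x \<in> K \<Longrightarrow> infdist x P \<le> e" "\<And>x. x \<in> frontier K \<Longrightarrow> x extreme_point_of K"
      using strictly_convex_approximation[OF assms \<open>0 < e\<close>] by blast
    have "interior K \<noteq> {}"
      using K(3) assms(3) by blast
    then obtain Q where Q: "vertex_generated Q" "Q \<subseteq> K" "\<And>x. x \<in> K \<Longrightarrow> infdist x Q \<le> e"
      using vertex_generated_inscribed_approximation[OF K(1,2) _ K(5) \<open>0 < e\<close>] by blast
    \<comment> \<open>\<open>K\<close> mediates: it contains both \<open>Q\<close> and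
      \<open>P\<close>, and each of its points is within \<open>e\<close> of either.\<close>
    have "\<bar>hausdorff_dist Q P\<bar> \<le> e"
    proof (rule hausdorff_dist_le)
      show "Q \<noteq> {}" "P \<noteq> {}"
        using Q(1) assms(3) by (auto simp: vertex_generated_def)
      show "infdist x P \<le> e" if "x \<in> Q" for x
        using that Q(2) K(4) by blast
      show "infdist x Q \<le> e" if "x \<in> P" for x
        using that Q(3) K(3) interior_subset by blast
    qed
    then show ?thesis
      using Q(1) by blast
  qed
  then have "\<forall>m. \<exists>Q. vertex_generated Q \<and> \<bar>hausdorff_dist Q P\<bar> \<le> inverse (real (Suc m))"
    by simp
  then obtain Q where Q: "\<And>m. vertex_generated (Q m)"
      "\<And>m. \<bar>hausdorff_dist (Q m) P\<bar> \<le> inverse (real (Suc m))"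
    by metis
  have "(\<lambda>m. hausdorff_dist (Q m) P) \<longlonglongrightarrow> 0"
    by (rule Lim_null_comparison[OF _ LIMSEQ_inverse_real_of_nat]) (simp add: Q(2) del: of_nat_Suc)
  then show ?thesis
    using Q(1) by blast
qed

end
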